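(* Given an $n$-vertex graph $G$ as a stream in the AL model and an integer $k$, one can produce (as a stream) a kernel with at most $2k$ vertices for \textsc{Vertex Cover} $[k]$ using $O(k^2)$ passes and $\tilde{O}(k)$ bits of memory. If $G$ is instead given as a stream in the EA model, the same can be done using $O(k^3)$ passes and $\tilde{O}(k)$ bits of memory.
   Context: \textsc{Vertex Cover} $[k]$: given a graph $G$ and integer $k$, decide whether $G$ has a vertex cover (a vertex set meeting every edge) of size at most $k$. A kernel of size $2k$ is an instance $(G',k')$ with $|V(G')| \le 2k$ and $k' \le k$ such that $G$ has a vertex cover of size at most $k$ if and only if $G'$ has one of size at most $k'$ (the procedure may alternatively correctly report that no solution exists). In the Adjacency List (AL) model the graph arrives as a sequence of vertices in arbitrary fixed order, each with the full list of its incident edges (each edge appears twice); in the Edge Arrival (EA) model each edge appears exactly once, in arbitrary fixed order. A $p$-pass algorithm reads the stream $p$ times with unlimited computation. $\tilde{O}(k)$ denotes $O(k)$ up to factors polylogarithmic in $n$. *)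

theory Defs imports Complex_Main begin

record graph =
  verts :: "nat set"
  edges :: "nat set set"

definition simple_graph :: "graph \<Rightarrow> bool" where
  "simple_graph G \<longleftrightarrow> finite (verts G) \<and> (\<forall>e\<in>edges G. e \<subseteq> verts G \<and> card e = 2)"

definition vertex_cover :: "graph \<Rightarrow> nat set \<Rightarrow> bool" where
  "vertex_cover G C \<longleftrightarrow> C \<subseteq> verts G \<and> (\<forall>e\<in>edges G. C \<inter> e \<noteq> {})"

definition has_vertex_cover :: "graph \<Rightarrow> nat \<Rightarrow> bool" where
  "has_vertex_cover G k \<longleftrightarrow> (\<exists>C. vertex_cover G C \<and> card C \<le> k)"

definition is_2k_kernel :: "graph \<Rightarrow> nat \<Rightarrow> graph \<Rightarrow> nat \<Rightarrow> bool" where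
  "is_2k_kernel G k G' k' \<longleftrightarrow>
     simple_graph G' \<and> card (verts G') \<le> 2 * k \<and> k' \<le> k \<and>
     (has_vertex_cover G k \<longleftrightarrow> has_vertex_cover G' k')"


(* The vertices and the individual incident edges are separate stream items, so that an
   algorithm has to spend memory on whatever it retains of a partially read neighbourhood.
   Incidence v w is the edge {v, w} in the list of v. *)
datatype al_item = Vertex nat | Incidence nat nat

definition al_stream :: "graph \<Rightarrow> al_item list \<Rightarrow> bool" where
  "al_stream G xs \<longleftrightarrow>
     (\<exists>vs nbrs. distinct vs \<and> set vs = verts G \<and>
        (\<forall>v\<in>verts G. distinct (nbrs v) \<and> set (nbrs v) = {w. {v, w} \<in> edges G}) \<and>
        xs = concat (map (\<lambda>v. Vertex v # map (Incidence v) (nbrs v)) vs))"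

(* Each edge is presented by its two endpoints, in arbitrary order. *)
definition ea_stream :: "graph \<Rightarrow> (nat \<times> nat) list \<Rightarrow> bool" where
  "ea_stream G xs \<longleftrightarrow>
     distinct (map (\<lambda>(u, v). {u, v}) xs) \<and> (\<lambda>(u, v). {u, v}) ` set xs = edges G"


datatype verdict = No_Solution | Kernel nat

(* A deterministic multi-pass streaming algorithm. The two leading arguments of every component
   are the number n of vertices and the parameter k, both known in advance.
   The memory content is a bit string. Computation is unlimited, hence the components are
   arbitrary functions, but all that survives from one stream item to the next is the bit string.
   On each item the algorithm may append items to a write-only output stream; the item None
   signals the end of a pass. The verdict is read off the final memory content;
   Kernel k' declares the output stream to be a graph G' that, with k', forms a kernel. *)
record 'i streaming_alg =
  passes :: "nat \<Rightarrow> nat \<Rightarrow> nat"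
  init :: "nat \<Rightarrow> nat \<Rightarrow> bool list"
  step :: "nat \<Rightarrow> nat \<Rightarrow> bool list \<Rightarrow> 'i option \<Rightarrow> bool list \<times> 'i list"
  verdict :: "nat \<Rightarrow> nat \<Rightarrow> bool list \<Rightarrow> verdict"

primrec exec :: "(bool list \<Rightarrow> 'i option \<Rightarrow> bool list \<times> 'i list) \<Rightarrow>
    bool list \<Rightarrow> 'i option list \<Rightarrow> bool list \<times> 'i list" where
  "exec f m [] = (m, [])"
| "exec f m (x # xs) =
     (let (m', out) = f m x; (m'', out') = exec f m' xs in (m'', out @ out'))"

definition tape :: "nat \<Rightarrow> 'i list \<Rightarrow> 'i option list" where
  "tape p xs = concat (replicate p (map Some xs @ [None]))"

(* the memory content and the output so far, after the first t items *)
definition config_at :: "'i streaming_alg \<Rightarrow> nat \<Rightarrow> nat \<Rightarrow> 'i list \<Rightarrow> nat \<Rightarrow> bool list \<times> 'i list" where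
  "config_at A n k xs t = exec (step A n k) (init A n k) (take t (tape (passes A n k) xs))"

definition final_config :: "'i streaming_alg \<Rightarrow> nat \<Rightarrow> nat \<Rightarrow> 'i list \<Rightarrow> bool list \<times> 'i list" where
  "final_config A n k xs = exec (step A n k) (init A n k) (tape (passes A n k) xs)"

definition input_graph :: "nat \<Rightarrow> graph \<Rightarrow> bool" where
  "input_graph n G \<longleftrightarrow> simple_graph G \<and> verts G = {..<n}"

(* The output is in the same stream model as the input. *)
definition produces_2k_kernel :: "(graph \<Rightarrow> 'i list \<Rightarrow> bool) \<Rightarrow> 'i streaming_alg \<Rightarrow> bool" where
  "produces_2k_kernel is_stream A \<longleftrightarrow>
     (\<forall>n k G xs. input_graph n G \<longrightarrow> is_stream G xs \<longrightarrow>
        (case final_config A n k xs of (m, out) \<Rightarrow>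
          (case verdict A n k m of
             No_Solution \<Rightarrow> \<not> has_vertex_cover G k
           | Kernel k' \<Rightarrow> \<exists>G'. is_stream G' out \<and> is_2k_kernel G k G' k')))"

(* The bounds are for k \<ge> 1; max 1 k makes them constant (up to polylog n) for k = 0, where
   the algorithm still has to find out whether there is an edge. *)
definition passes_O_power :: "'i streaming_alg \<Rightarrow> nat \<Rightarrow> bool" where
  "passes_O_power A e \<longleftrightarrow> (\<exists>c. \<forall>n k. passes A n k \<le> c * max 1 k ^ e)"

(* n + 2 instead of n keeps the logarithm positive. *)
definition memory_soft_O_k :: "(graph \<Rightarrow> 'i list \<Rightarrow> bool) \<Rightarrow> 'i streaming_alg \<Rightarrow> bool" where
  "memory_soft_O_k is_stream A \<longleftrightarrow>
     (\<exists>(c :: real) (d :: nat). \<forall>n k G xs t. input_graph n G \<longrightarrow> is_stream G xs \<longrightarrow>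
        real (length (fst (config_at A n k xs t))) \<le>
          c * real (max 1 k) * log 2 (real n + 2) ^ d)"

end

theory Submission imports Defs begin

text \<open>
  A maximum matching \<open>M\<close> of the bipartite double cover is found by repeated augmentation. If it has
  more than \<open>2 * k\<close> arcs, no vertex cover of size \<open>k\<close> exists; otherwise a Koenig cover of size
  \<open>card M\<close> is a half-integral optimum of the vertex cover LP, and by Nemhauser and Trotter the
  vertices of weight 1/2 induce a kernel. An alternating forest is grown edge by edge in whatever
  order the stream has: a pass either enlarges the forest, augments the matching, or leaves the
  state fixed for good. Since matching and forest have at most \<open>2 * k + 1\<close> arcs, \<open>O(k\<^sup>2)\<close> passes
  suffice in both models.
\<close>

subsection \<open>The Nemhauser-Trotter kernel from a bipartite cover\<close>

definition matching :: "('a \<times> 'b) set \<Rightarrow> bool" where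
  "matching M \<longleftrightarrow> inj_on fst M \<and> inj_on snd M"

text \<open>The bipartite double cover: \<open>(u, v)\<close> joins the left copy of
  \<open>u\<close> to the right copy of \<open>v\<close>, so every edge yields two arcs.\<close>

definition arcs :: "graph \<Rightarrow> (nat \<times> nat) set" where
  "arcs G = {(u, v). {u, v} \<in> edges G}"

definition induced :: "graph \<Rightarrow> nat set \<Rightarrow> graph" where
  "induced G W = \<lparr>verts = W, edges = {e \<in> edges G. e \<subseteq> W}\<rparr>"

lemma arcs_sym: "(u, v) \<in> arcs G \<Longrightarrow> (v, u) \<in> arcs G"
  by (simp add: arcs_def insert_commute)

lemma arcs_subset:
  assumes "simple_graph G" shows "arcs G \<subseteq> verts G \<times> verts G"
  using assms by (auto simp: arcs_def simple_graph_def)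

lemma simple_graph_edgeE:
  assumes "simple_graph G" "e \<in> edges G"
  obtains u v where "e = {u, v}" "(u, v) \<in> arcs G"
proof -
  have "card e = 2" using assms by (auto simp: simple_graph_def)
  then obtain u v where "e = {u, v}" by (auto simp: card_2_iff)
  then show thesis using that assms(2) by (auto simp: arcs_def)
qed

lemma simple_graph_induced:
  assumes "simple_graph G" "W \<subseteq> verts G" shows "simple_graph (induced G W)"
  using assms by (auto simp: simple_graph_def induced_def intro: finite_subset)

text \<open>Weak duality: charge each arc to an endpoint in the cover. Both projections are
  injective on a matching, so no vertex is charged twice on the same side.\<close>

lemma matching_le_cover:
  assumes "matching M" "finite A" "finite B" "\<And>u v. (u, v) \<in> M \<Longrightarrow> u \<in> A \<or> v \<in> B"
  shows "card M \<le> card A + card B"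
proof -
  define M1 where "M1 = {e \<in> M. fst e \<in> A}"
  define M2 where "M2 = {e \<in> M. snd e \<in> B}"
  have inj: "inj_on fst M1" "inj_on snd M2"
    using assms(1) by (auto simp: matching_def M1_def M2_def inj_on_def)
  have img: "fst ` M1 \<subseteq> A" "snd ` M2 \<subseteq> B" by (auto simp: M1_def M2_def)
  have fin: "finite M1" "finite M2"
    using inj_on_finite[OF inj(1) img(1)] inj_on_finite[OF inj(2) img(2)] assms(2,3) by auto
  have "M \<subseteq> M1 \<union> M2" using assms(4) by (force simp: M1_def M2_def)
  then have "card M \<le> card (M1 \<union> M2)" using fin by (intro card_mono) auto
  also have "\<dots> \<le> card M1 + card M2" by (rule card_Un_le)
  also have "\<dots> \<le> card A + card B"
    using card_inj_on_le[OF inj(1) img(1)] card_inj_on_le[OF inj(2) img(2)] assms(2,3) by auto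
  finally show ?thesis .
qed

text \<open>The left and right copies of \<open>C\<close> together cover the double cover. This
  justifies reporting that there is no solution when the matching gets too large.\<close>

lemma matching_le_vertex_cover:
  assumes G: "simple_graph G" and M: "matching M" "M \<subseteq> arcs G" and C: "vertex_cover G C"
  shows "card M \<le> 2 * card C"
proof -
  have "finite C" using C G by (auto simp: vertex_cover_def simple_graph_def intro: finite_subset)
  moreover have "u \<in> C \<or> v \<in> C" if "(u, v) \<in> M" for u v
    using that M C by (auto simp: arcs_def vertex_cover_def)
  ultimately have "card M \<le> card C + card C"
    using M by (intro matching_le_cover) auto
  then show ?thesis by simp
qed

text \<open>A vertex \<open>v\<close> has weight 1, 1/2 or 0 in the half-integral optimum when it lies in both, one
  or none of \<open>A\<close> and \<open>B\<close>.\<close>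

lemma is_2k_kernel_half:
  assumes G: "simple_graph G" and M: "matching M" "M \<subseteq> arcs G" "card M \<le> 2 * k"
    and AB: "A \<subseteq> verts G" "B \<subseteq> verts G" "card A + card B = card M"
    and cov: "\<And>u v. (u, v) \<in> arcs G \<Longrightarrow> u \<in> A \<or> v \<in> B"
  shows "is_2k_kernel G k (induced G ((A \<union> B) - (A \<inter> B))) (k - card (A \<inter> B))"
proof -
  define H where "H = (A \<union> B) - (A \<inter> B)"
  define I where "I = A \<inter> B"
  have finV: "finite (verts G)" using G by (simp add: simple_graph_def)
  have fin: "finite A" "finite B" "finite H" "finite I"
    using AB finV by (auto simp: H_def I_def intro: finite_subset)
  have HV: "H \<subseteq> verts G" and IV: "I \<subseteq> verts G" using AB by (auto simp: H_def I_def)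
  have sum: "card (A \<union> B) + card I = card M"
    using card_Un_Int[of A B] fin AB by (simp add: I_def)
  have "card H \<le> card (A \<union> B)" unfolding H_def using fin by (intro card_mono) auto
  then have cH: "card H \<le> 2 * k" using sum M(3) by linarith
  \<comment> \<open>Twice \<open>card I\<close> is at most \<open>card M\<close>, hence at most
    \<open>2 * k\<close>, so the subtraction \<open>k - card I\<close> does not truncate.\<close>
  have "card I \<le> card (A \<union> B)" unfolding I_def using fin by (intro card_mono) auto
  then have cI: "card I \<le> k" using sum M(3) by linarith
  have "has_vertex_cover G k \<longleftrightarrow> has_vertex_cover (induced G H) (k - card I)"
  proof
    assume "has_vertex_cover G k"
    then obtain S where S: "vertex_cover G S" "card S \<le> k" by (auto simp: has_vertex_cover_def)
    have SV: "S \<subseteq> verts G" using S by (simp add: vertex_cover_def)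
    then have finS: "finite S" using finV finite_subset by auto
    \<comment> \<open>Lowering the weight of \<open>I - S\<close> to 1/2 and raising that of \<open>S - (A \<union> B)\<close> to 1/2 yields
      another fractional cover; its bipartite form puts the positive weights on the left and the
      weights 1 on the right.\<close>
    have "card M \<le> card (A \<union> B \<union> (S - (A \<union> B))) + card (I \<inter> S)"
    proof (rule matching_le_cover[OF M(1)])
      fix u v assume "(u, v) \<in> M"
      then have uv: "(u, v) \<in> arcs G" "(v, u) \<in> arcs G" using M arcs_sym by auto
      then have "u \<in> S \<or> v \<in> S" using S by (auto simp: arcs_def vertex_cover_def)
      then show "u \<in> A \<union> B \<union> (S - (A \<union> B)) \<or> v \<in> I \<inter> S"
        using cov[OF uv(1)] cov[OF uv(2)] by (auto simp: I_def)
    qed (use fin finS in auto)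
    also have "card (A \<union> B \<union> (S - (A \<union> B))) = card (A \<union> B) + card (S - (A \<union> B))"
      using fin finS by (intro card_Un_disjoint) auto
    finally have le: "card I \<le> card (S - (A \<union> B)) + card (I \<inter> S)" using sum by linarith
    have "card S = card (S - (A \<union> B)) + card (S \<inter> (A \<union> B))"
      using card_Int_Diff[OF finS] by (simp add: add.commute)
    also have "S \<inter> (A \<union> B) = (I \<inter> S) \<union> (S \<inter> H)" by (auto simp: H_def I_def)
    also have "card \<dots> = card (I \<inter> S) + card (S \<inter> H)"
      using finS by (intro card_Un_disjoint) (auto simp: H_def I_def)
    finally have "card S = card (S - (A \<union> B)) + (card (I \<inter> S) + card (S \<inter> H))" .
    \<comment> \<open>By \<open>le\<close>, the part of \<open>S\<close> outside \<open>H\<close> is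
      at least as large as \<open>I\<close>.\<close>
    then have "card (S \<inter> H) \<le> k - card I" using le S(2) by linarith
    moreover have "vertex_cover (induced G H) (S \<inter> H)"
      using S by (fastforce simp: vertex_cover_def induced_def)
    ultimately show "has_vertex_cover (induced G H) (k - card I)"
      by (auto simp: has_vertex_cover_def)
  next
    assume "has_vertex_cover (induced G H) (k - card I)"
    then obtain T where T: "vertex_cover (induced G H) T" "card T \<le> k - card I"
      by (auto simp: has_vertex_cover_def)
    have TH: "T \<subseteq> H" using T by (simp add: vertex_cover_def induced_def)
    have "vertex_cover G (T \<union> I)"
      unfolding vertex_cover_def
    proof (intro conjI ballI)
      show "T \<union> I \<subseteq> verts G" using TH HV IV by auto
      fix e assume e: "e \<in> edges G"
      then obtain u v where uv: "e = {u, v}" "(u, v) \<in> arcs G" by (rule simple_graph_edgeE[OF G])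
      show "(T \<union> I) \<inter> e \<noteq> {}"
      proof (cases "e \<subseteq> H")
        case True
        then show ?thesis using T e by (auto simp: vertex_cover_def induced_def)
      next
        case False
        \<comment> \<open>An endpoint outside \<open>H\<close> lies in \<open>I\<close> or in
          neither set. In the latter case the two orientations of the edge force the other endpoint
          into both \<open>A\<close> and \<open>B\<close>.\<close>
        then show ?thesis using cov[OF uv(2)] cov[OF arcs_sym[OF uv(2)]] uv(1)
          by (auto simp: H_def I_def)
      qed
    qed
    moreover have "card (T \<union> I) \<le> k" using card_Un_le[of T I] T(2) cI by linarith
    ultimately show "has_vertex_cover G k" by (auto simp: has_vertex_cover_def)
  qed
  then show ?thesis
    using simple_graph_induced[OF G HV] cH
    unfolding is_2k_kernel_def H_def I_def by (simp add: induced_def)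
qed


subsection \<open>Augmenting a matching edge by edge\<close>

text \<open>A state \<open>(M, F)\<close> is a matching of the bipartite double cover with an alternating forest:
  \<open>F\<close> contains the parent arc of every right vertex reached so far. The left vertices in
  \<open>unreached M F\<close> are not reachable along alternating paths from free left vertices within
  \<open>M \<union> F\<close>.\<close>

definition unreached :: "(nat \<times> nat) set \<Rightarrow> (nat \<times> nat) set \<Rightarrow> nat set" where
  "unreached M F = {u. \<exists>v. (u, v) \<in> M \<and> v \<notin> snd ` F}"

text \<open>Confining \<open>M'\<close> to the stored arcs and the current one means that it can be
  found without consulting the stream.\<close>

definition augments :: "(nat \<times> nat) set \<Rightarrow> (nat \<times> nat) set \<Rightarrow> nat \<times> nat \<Rightarrow> (nat \<times> nat) set \<Rightarrow> bool" where
  "augments M F e M' \<longleftrightarrow> matching M' \<and> M' \<subseteq> insert e (M \<union> F) \<and> card M' = Suc (card M)"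

text \<open>One step of an alternating search. A free \<open>v\<close> completes an augmenting path;
  afterwards the old forest need not fit the new matching, so the search restarts. A matching larger
  than \<open>2 * k\<close> already refutes a cover of size \<open>k\<close>, and freezing it bounds
  the memory.\<close>

fun update :: "nat \<Rightarrow> nat \<times> nat \<Rightarrow> (nat \<times> nat) set \<times> (nat \<times> nat) set
    \<Rightarrow> (nat \<times> nat) set \<times> (nat \<times> nat) set" where
  "update k (u, v) (M, F) =
     (if card M > 2 * k \<or> v \<in> snd ` F \<or> u \<in> unreached M F then (M, F)
      else if v \<in> snd ` M then (M, insert (u, v) F)
      else (SOME M'. augments M F (u, v) M', {}))"

text \<open>The last condition of the invariant says that flipping an alternating path frees any reached left vertex.\<close>

definition search_inv :: "(nat \<times> nat) set \<Rightarrow> nat \<Rightarrow> (nat \<times> nat) set \<times> (nat \<times> nat) set \<Rightarrow> bool" where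
  "search_inv D k = (\<lambda>(M, F).
     matching M \<and> M \<subseteq> D \<and> F \<subseteq> D \<and> card M \<le> 2 * k + 1 \<and> inj_on snd F \<and> snd ` F \<subseteq> snd ` M \<and>
     (\<forall>u. u \<notin> unreached M F \<longrightarrow>
        (\<exists>M'. matching M' \<and> M' \<subseteq> M \<union> F \<and> snd ` M' = snd ` M \<and> u \<notin> fst ` M')))"

text \<open>Lexicographic order on \<open>(card M, card F)\<close>: as \<open>card F\<close> stays
  below \<open>2 * k + 2\<close>, an augmentation outweighs the discarded forest.\<close>

definition potential :: "nat \<Rightarrow> (nat \<times> nat) set \<times> (nat \<times> nat) set \<Rightarrow> nat" where
  "potential k = (\<lambda>(M, F). card M * (2 * k + 2) + card F)"

section \<open>Preservation of the search invariant\<close>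

lemma search_inv_matching: "matching M \<Longrightarrow> M \<subseteq> D \<Longrightarrow> card M \<le> 2 * k + 1 \<Longrightarrow> search_inv D k (M, {})"
  unfolding search_inv_def unreached_def by (force intro!: exI[of _ M])

lemma search_inv_mono: "search_inv D k s \<Longrightarrow> D \<subseteq> D' \<Longrightarrow> search_inv D' k s"
  unfolding search_inv_def by (auto split: prod.splits)

lemma card_matching_snd: "matching M \<Longrightarrow> card (snd ` M) = card M"
  by (simp add: matching_def card_image)

text \<open>Distinct forest arcs have distinct heads, all of them matched.\<close>

lemma search_inv_card:
  assumes "search_inv D k (M, F)" "finite D"
  shows "card F \<le> card M" "card M \<le> 2 * k + 1" "card F \<le> 2 * k + 1"
proof -
  have fin: "finite M" using assms by (auto simp: search_inv_def intro: finite_subset)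
  have "card F = card (snd ` F)" using assms(1) by (simp add: search_inv_def card_image)
  also have "\<dots> \<le> card (snd ` M)"
    using assms(1) fin by (intro card_mono) (auto simp: search_inv_def)
  also have "\<dots> = card M" using assms(1) by (simp add: search_inv_def card_matching_snd)
  finally show *: "card F \<le> card M" .
  show "card M \<le> 2 * k + 1" using assms(1) by (simp add: search_inv_def)
  with * show "card F \<le> 2 * k + 1" by linarith
qed

text \<open>The invariant supplies a matching that covers the same right vertices as
  \<open>M\<close> and leaves \<open>u\<close> free. Since \<open>v\<close> is free there too,
  \<open>(u, v)\<close> can be added.\<close>

lemma ex_augments:
  assumes inv: "search_inv D k (M, F)" and D: "finite D"
    and u: "u \<notin> unreached M F" and v: "v \<notin> snd ` M"
  shows "\<exists>M'. augments M F (u, v) M'"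
proof -
  have M: "matching M" using inv by (simp add: search_inv_def)
  obtain M' where M': "matching M'" "M' \<subseteq> M \<union> F" "snd ` M' = snd ` M" "u \<notin> fst ` M'"
    using inv u by (auto simp: search_inv_def)
  have "finite M'" using M'(2) inv D by (auto simp: search_inv_def intro: finite_subset)
  moreover have "card M' = card M"
    using card_matching_snd[OF M'(1)] card_matching_snd[OF M] M'(3) by simp
  moreover have "(u, v) \<notin> M'" using M'(4) by force
  moreover have "matching (insert (u, v) M')"
    using M'(1) v M'(4) unfolding M'(3)[symmetric] matching_def inj_on_insert
    by (auto intro: inj_on_subset)
  ultimately show ?thesis
    using M'(2) by (intro exI[of _ "insert (u, v) M'"]) (auto simp: augments_def)
qed

text \<open>The only newly reached left vertex is the partner \<open>w\<close> of \<open>v\<close>.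
  In a matching that leaves \<open>u\<close> free, exchanging \<open>(w, v)\<close> for
  \<open>(u, v)\<close> frees \<open>w\<close> instead.\<close>

lemma search_inv_grow:
  assumes inv: "search_inv D k (M, F)" and e: "(u, v) \<in> D"
    and u: "u \<notin> unreached M F" and v: "v \<in> snd ` M" "v \<notin> snd ` F"
  shows "search_inv D k (M, insert (u, v) F)"
proof -
  have M: "matching M" using inv by (simp add: search_inv_def)
  have "\<exists>M'. matching M' \<and> M' \<subseteq> M \<union> insert (u, v) F \<and> snd ` M' = snd ` M \<and> w \<notin> fst ` M'"
    if w: "w \<notin> unreached M (insert (u, v) F)" for w
  proof (cases "w \<in> unreached M F")
    case False
    then obtain M' where "matching M'" "M' \<subseteq> M \<union> F" "snd ` M' = snd ` M" "w \<notin> fst ` M'"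
      using inv by (auto simp: search_inv_def)
    then show ?thesis by (intro exI[of _ M']) auto
  next
    case True
    then have wv: "(w, v) \<in> M" using w by (auto simp: unreached_def)
    obtain M' where M': "matching M'" "M' \<subseteq> M \<union> F" "snd ` M' = snd ` M" "u \<notin> fst ` M'"
      using inv u by (auto simp: search_inv_def)
    obtain x where x: "(x, v) \<in> M'" using v(1) M'(3) by force
    \<comment> \<open>No forest arc ends in \<open>v\<close> yet, so \<open>M'\<close> can match
      \<open>v\<close> only by an arc of \<open>M\<close>.\<close>
    then have "(x, v) \<in> M" using M'(2) v(2) by force
    then have "x = w" using wv M unfolding matching_def inj_on_def by force
    then have wv': "(w, v) \<in> M'" using x by simp
    have other: "snd y \<noteq> v" "fst y \<noteq> w" if "y \<in> M' - {(w, v)}" for y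
      using that wv' M'(1) unfolding matching_def inj_on_def by force+
    define N where "N = insert (u, v) (M' - {(w, v)})"
    have "matching N"
      using M'(1,4) other unfolding N_def matching_def inj_on_insert
      by (auto intro: inj_on_subset)
    moreover have "N \<subseteq> M \<union> insert (u, v) F" using M'(2) by (auto simp: N_def)
    moreover have "snd ` N = snd ` M'" using wv' by (force simp: N_def)
    moreover have "w \<notin> fst ` N" using other wv' M'(4) by (force simp: N_def)
    ultimately show ?thesis using M'(3) by metis
  qed
  then show ?thesis using inv e v by (auto simp: search_inv_def)
qed

lemma update_progress:
  assumes inv: "search_inv D k s" and D: "finite D" and e: "e \<in> D"
  shows "search_inv D k (update k e s) \<and>
    (update k e s = s \<or> potential k s < potential k (update k e s))"
proof -
  obtain M F u v where [simp]: "s = (M, F)" "e = (u, v)" by (metis surj_pair)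
  have MF: "matching M" "M \<subseteq> D" "F \<subseteq> D" using inv by (auto simp: search_inv_def)
  have fin: "finite F" using MF D finite_subset by auto
  note card = search_inv_card[OF inv[simplified] D]
  consider (same) "card M > 2 * k \<or> v \<in> snd ` F \<or> u \<in> unreached M F"
    | (grow) "\<not> card M > 2 * k" "v \<notin> snd ` F" "u \<notin> unreached M F" "v \<in> snd ` M"
    | (aug) "\<not> card M > 2 * k" "v \<notin> snd ` F" "u \<notin> unreached M F" "v \<notin> snd ` M" by blast
  then show ?thesis
  proof cases
    case same
    then show ?thesis using inv by auto
  next
    case grow
    have "search_inv D k (M, insert (u, v) F)"
      using search_inv_grow inv e grow by auto
    moreover have "(u, v) \<notin> F" using grow(2) by force
    ultimately show ?thesis using grow fin by (auto simp: potential_def)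
  next
    case aug
    define N where "N = (SOME M'. augments M F (u, v) M')"
    have "augments M F (u, v) N"
      unfolding N_def using ex_augments[OF inv[simplified] D aug(3,4)] by (rule someI_ex)
    then have N: "matching N" "N \<subseteq> D" "card N = Suc (card M)"
      using MF e by (auto simp: augments_def)
    have upd: "update k e s = (N, {})" using aug by (simp add: N_def)
    have "search_inv D k (N, {})" using N aug(1) by (intro search_inv_matching) auto
    moreover have "potential k s < potential k (N, {})"
      using N(3) card by (simp add: potential_def)
    ultimately show ?thesis unfolding upd by blast
  qed
qed

section \<open>Stabilization and the resulting Koenig cover\<close>

lemma potential_less:
  assumes "search_inv D k s" "finite D" shows "potential k s < (2 * k + 2)\<^sup>2"
proof -
  obtain M F where [simp]: "s = (M, F)" by (metis surj_pair)
  have c: "card M \<le> 2 * k + 1" "card F \<le> 2 * k + 1"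
    using search_inv_card[of D k M F] assms by auto
  have "card M * (2 * k + 2) \<le> (2 * k + 1) * (2 * k + 2)" using c(1) by (rule mult_right_mono) simp
  then have "potential k s < (2 * k + 1) * (2 * k + 2) + (2 * k + 2)"
    using c(2) by (simp add: potential_def)
  also have "\<dots> = (2 * k + 2)\<^sup>2" by (simp add: power2_eq_square algebra_simps)
  finally show ?thesis .
qed

text \<open>Koenig's argument: an arc missed by the unreached left vertices and the forest heads
  would have enlarged the forest or the matching.\<close>

lemma update_stable:
  assumes inv: "search_inv D k (M, F)" and D: "finite D" and uv: "(u, v) \<in> D"
    and small: "card M \<le> 2 * k" and eq: "update k (u, v) (M, F) = (M, F)"
  shows "u \<in> unreached M F \<or> v \<in> snd ` F"
proof (rule ccontr)
  assume *: "\<not> ?thesis"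
  show False
  proof (cases "v \<in> snd ` M")
    case True
    then have "insert (u, v) F = F" using * eq small by simp
    then show False using * by force
  next
    case False
    have u: "u \<notin> unreached M F" using * by simp
    have "augments M F (u, v) (SOME M'. augments M F (u, v) M')"
      using ex_augments[OF inv D u False] by (rule someI_ex)
    moreover have "fst (update k (u, v) (M, F)) = (SOME M'. augments M F (u, v) M')"
      using * small False by simp
    then have "(SOME M'. augments M F (u, v) M') = M" unfolding eq fst_conv by (rule sym)
    ultimately show False by (simp add: augments_def)
  qed
qed

text \<open>Every change raises the potential, so changes within a pass cannot cancel: if a pass
  ends where it began, every single arc was inert.\<close>

lemma fold_update_progress:
  assumes "search_inv D k s" "finite D" "set es \<subseteq> D"
  shows "search_inv D k (fold (update k) es s) \<and>
    ((\<forall>e\<in>set es. update k e s = s) \<and> fold (update k) es s = s \<or>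
     potential k s < potential k (fold (update k) es s))"
  using assms
proof (induction es arbitrary: s)
  case (Cons e es)
  show ?case
    using update_progress[of D k s e] Cons.IH[of "update k e s"] Cons.prems by auto
qed simp

lemma search_stabilizes:
  assumes "search_inv D k s" "finite D" "set es \<subseteq> D"
  defines "T \<equiv> (fold (update k) es ^^ (2 * k + 2)\<^sup>2) s"
  shows "search_inv D k T" "\<forall>e\<in>set es. update k e T = T"
proof -
  let ?f = "fold (update k) es"
  \<comment> \<open>Until the state is fixed, each pass raises the potential by at least 1, which
    contradicts \<open>potential_less\<close> after \<open>(2 * k + 2)\<^sup>2\<close>
    passes.\<close>
  have *: "search_inv D k ((?f ^^ j) s) \<and>
      ((\<forall>e\<in>set es. update k e ((?f ^^ j) s) = (?f ^^ j) s) \<and> ?f ((?f ^^ j) s) = (?f ^^ j) s \<or>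
       j \<le> potential k ((?f ^^ j) s))" for j
  proof (induction j)
    case (Suc j)
    then show ?case using fold_update_progress[of D k "(?f ^^ j) s" es] assms(2,3) by auto
  qed (simp add: assms)
  show "search_inv D k T" using * by (simp add: T_def)
  then show "\<forall>e\<in>set es. update k e T = T"
    using *[of "(2 * k + 2)\<^sup>2"] potential_less[of D k T] assms(2) by (auto simp: T_def)
qed

text \<open>\<open>M\<close> pairs the unreached left vertices with the matched right vertices
  outside the forest. Hence the Koenig cover is as large as the matching.\<close>

lemma card_unreached:
  assumes inv: "search_inv D k (M, F)" and D: "finite D"
  shows "card (unreached M F) + card (snd ` F) = card M"
proof -
  have M: "matching M" "finite M" "snd ` F \<subseteq> snd ` M"
    using inv D by (auto simp: search_inv_def intro: finite_subset)
  let ?N = "{e \<in> M. snd e \<notin> snd ` F}"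
  have "unreached M F = fst ` ?N" by (force simp: unreached_def)
  moreover have "inj_on fst ?N" "inj_on snd ?N"
    using M(1) by (auto simp: matching_def intro: inj_on_subset)
  ultimately have "card (unreached M F) = card (snd ` ?N)" by (simp add: card_image)
  also have "snd ` ?N = snd ` M - snd ` F" by auto
  also have "card \<dots> = card M - card (snd ` F)"
    using card_Diff_subset[OF _ M(3)] finite_subset[OF M(3)] M(2) card_matching_snd[OF M(1)] by simp
  finally show ?thesis
    using M(2) card_mono[OF _ M(3)] card_matching_snd[OF M(1)] by simp
qed


subsection \<open>The streaming algorithm\<close>

text \<open>The vertices of weight 1/2, which lie in exactly one side of the Koenig cover.\<close>

definition half_integral :: "(nat \<times> nat) set \<times> (nat \<times> nat) set \<Rightarrow> nat set" where
  "half_integral = (\<lambda>(M, F). (unreached M F \<union> snd ` F) - (unreached M F \<inter> snd ` F))"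

lemma half_integral_subset: "search_inv (V \<times> V) k s \<Longrightarrow> half_integral s \<subseteq> V"
  by (cases s) (auto simp: search_inv_def half_integral_def unreached_def)

definition decide :: "nat \<Rightarrow> (nat \<times> nat) set \<times> (nat \<times> nat) set \<Rightarrow> verdict" where
  "decide k = (\<lambda>(M, F). if card M > 2 * k then No_Solution
     else Kernel (k - card (unreached M F \<inter> snd ` F)))"

text \<open>Stability under all arcs makes the state a certificate: an oversized matching, or a
  Koenig cover that is tight for \<open>M\<close>.\<close>

lemma decide_stable:
  assumes G: "simple_graph G" and inv: "search_inv (arcs G) k s"
    and stable: "\<forall>e\<in>arcs G. update k e s = s"
  shows "case decide k s of No_Solution \<Rightarrow> \<not> has_vertex_cover G k
    | Kernel k' \<Rightarrow> is_2k_kernel G k (induced G (half_integral s)) k'"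
proof -
  obtain M F where s: "s = (M, F)" by (metis surj_pair)
  have M: "matching M" "M \<subseteq> arcs G" "F \<subseteq> arcs G" using inv by (auto simp: s search_inv_def)
  have fin: "finite (arcs G)"
    using arcs_subset[OF G] G by (auto simp: simple_graph_def intro: finite_subset)
  show ?thesis
  proof (cases "card M > 2 * k")
    case True
    have "\<not> has_vertex_cover G k"
    proof
      assume "has_vertex_cover G k"
      then obtain C where "vertex_cover G C" "card C \<le> k" by (auto simp: has_vertex_cover_def)
      then show False using matching_le_vertex_cover[OF G M(1,2)] True by fastforce
    qed
    then show ?thesis using True by (simp add: s decide_def)
  next
    case False
    then have small: "card M \<le> 2 * k" by simp
    have "is_2k_kernel G k (induced G ((unreached M F \<union> snd ` F) - (unreached M F \<inter> snd ` F)))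
      (k - card (unreached M F \<inter> snd ` F))"
    proof (rule is_2k_kernel_half[OF G M(1,2) small])
      show "unreached M F \<subseteq> verts G" "snd ` F \<subseteq> verts G"
        using M arcs_subset[OF G] by (auto simp: unreached_def)
      show "card (unreached M F) + card (snd ` F) = card M"
        using card_unreached inv fin by (simp add: s)
      show "u \<in> unreached M F \<or> v \<in> snd ` F" if "(u, v) \<in> arcs G" for u v
        using stable[unfolded s] that by (intro update_stable[OF inv[unfolded s] fin that small]) blast
    qed
    then show ?thesis using False by (simp add: s decide_def half_integral_def)
  qed
qed

text \<open>An item \<open>i\<close> announces the arcs \<open>dir i\<close> and mentions the vertices \<open>ends i\<close>. The first
  component of the state counts the completed passes; the last pass writes the output.\<close>

definition machine :: "('i \<Rightarrow> (nat \<times> nat) list) \<Rightarrow> ('i \<Rightarrow> nat set) \<Rightarrow> nat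
    \<Rightarrow> nat \<times> (nat \<times> nat) set \<times> (nat \<times> nat) set \<Rightarrow> 'i option
    \<Rightarrow> (nat \<times> (nat \<times> nat) set \<times> (nat \<times> nat) set) \<times> 'i list" where
  "machine dir ends k = (\<lambda>(j, s) x. case x of
     None \<Rightarrow> ((if j < (2 * k + 2)\<^sup>2 then Suc j else j, s), [])
   | Some i \<Rightarrow>
       if j < (2 * k + 2)\<^sup>2 then ((j, fold (update k) (dir i) s), [])
       else ((j, s), if ends i \<subseteq> half_integral s then [i] else []))"

text \<open>All pairs below \<open>n\<close> take the place of the arcs of the graph, since the
  encoding of states must be fixed before the graph is known.\<close>

definition machine_states :: "nat \<Rightarrow> nat \<Rightarrow> (nat \<times> (nat \<times> nat) set \<times> (nat \<times> nat) set) set" where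
  "machine_states n k = {..(2 * k + 2)\<^sup>2} \<times> Collect (search_inv ({..<n} \<times> {..<n}) k)"

section \<open>Simulation of abstract states by bit strings\<close>

primrec run :: "('s \<Rightarrow> 'i option \<Rightarrow> 's \<times> 'i list) \<Rightarrow> 's \<Rightarrow> 'i option list \<Rightarrow> 's \<times> 'i list" where
  "run f s [] = (s, [])"
| "run f s (x # xs) = (let (s', out) = f s x; (s'', out') = run f s' xs in (s'', out @ out'))"

definition coded :: "('s \<Rightarrow> bool list) \<Rightarrow> 's set \<Rightarrow> ('s \<Rightarrow> 'i option \<Rightarrow> 's \<times> 'i list)
    \<Rightarrow> bool list \<Rightarrow> 'i option \<Rightarrow> bool list \<times> 'i list" where
  "coded enc S f m x = map_prod enc id (f (inv_into S enc m) x)"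

lemma run_append:
  "run f s (xs @ ys) = (let (s', out) = run f s xs; (s'', out') = run f s' ys in (s'', out @ out'))"
  by (induction xs arbitrary: s) (auto split: prod.splits)

text \<open>While the states stay in \<open>S\<close>, decoding inverts encoding, so the coded
  machine mirrors the abstract one and emits the same output.\<close>

lemma exec_coded:
  assumes "inj_on enc S" "\<And>s x. s \<in> S \<Longrightarrow> x \<in> X \<Longrightarrow> fst (f s x) \<in> S" "s \<in> S" "set ys \<subseteq> X"
  shows "exec (coded enc S f) (enc s) ys = map_prod enc id (run f s ys) \<and> fst (run f s ys) \<in> S"
  using assms(3,4)
proof (induction ys arbitrary: s)
  case (Cons y ys)
  obtain s' out where y: "f s y = (s', out)" by (metis surj_pair)
  have s': "s' \<in> S" using assms(2)[of s y] Cons.prems y by simp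
  have "coded enc S f (enc s) y = (enc s', out)"
    using Cons.prems assms(1) y by (simp add: coded_def)
  then show ?case using Cons.IH[OF s'] Cons.prems y by (auto split: prod.splits)
qed simp

lemma machine_closed:
  assumes "s \<in> machine_states n k" "\<And>i. x = Some i \<Longrightarrow> set (dir i) \<subseteq> {..<n} \<times> {..<n}"
  shows "fst (machine dir ends k s x) \<in> machine_states n k"
  using assms fold_update_progress[of "{..<n} \<times> {..<n}" k "snd s"]
  by (auto simp: machine_def machine_states_def split: option.splits)

lemma tape_Suc: "tape (Suc p) xs = tape p xs @ map Some xs @ [None]"
proof -
  have "replicate (Suc p) ys = replicate p ys @ [ys]" for ys :: "'a option list"
    by (simp add: replicate_append_same)
  then show ?thesis by (simp only: tape_def concat_append concat.simps append_Nil2)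
qed

lemma run_search:
  assumes "j < (2 * k + 2)\<^sup>2"
  shows "run (machine dir ends k) (j, s) (map Some xs)
    = ((j, fold (update k) (concat (map dir xs)) s), [])"
  using assms by (induction xs arbitrary: s) (auto simp: machine_def)

lemma run_search_passes:
  assumes "j \<le> (2 * k + 2)\<^sup>2"
  shows "run (machine dir ends k) (0, s) (tape j xs)
    = ((j, (fold (update k) (concat (map dir xs)) ^^ j) s), [])"
  using assms
proof (induction j)
  case 0
  then show ?case by (simp add: tape_def)
next
  case (Suc j)
  then show ?case by (simp add: tape_Suc run_append run_search) (simp add: machine_def)
qed

text \<open>The saturated counter keeps the state constant during the output pass, so all items are
  filtered by the same vertex set and the verdict belongs to that state too.\<close>

lemma run_output:
  assumes "\<not> j < (2 * k + 2)\<^sup>2"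
  shows "run (machine dir ends k) (j, s) (map Some xs @ [None])
    = ((j, s), filter (\<lambda>i. ends i \<subseteq> half_integral s) xs)"
  using assms by (induction xs) (auto simp: machine_def)


subsection \<open>Memory\<close>

lemma ex_bit_encoding:
  assumes "finite S" "card S \<le> 2 ^ L"
  shows "\<exists>enc :: 'a \<Rightarrow> bool list. inj_on enc S \<and> (\<forall>s\<in>S. length (enc s) = L)"
proof -
  let ?B = "{xs :: bool list. set xs \<subseteq> UNIV \<and> length xs = L}"
  have "finite ?B" "card S \<le> card ?B"
    using assms(2) by (simp_all only: finite_lists_length_eq card_lists_length_eq finite card_UNIV_bool)
  then show ?thesis using card_le_inj[OF assms(1), of ?B] by blast
qed

text \<open>A subset with at most \<open>K\<close> elements can be read off a word of length
  \<open>K\<close>, padded with the extra letter \<open>None\<close>.\<close>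

lemma card_small_subsets:
  assumes "finite X"
  shows "finite {A. A \<subseteq> X \<and> card A \<le> K}" "card {A. A \<subseteq> X \<and> card A \<le> K} \<le> (card X + 1) ^ K"
proof -
  let ?S = "{A. A \<subseteq> X \<and> card A \<le> K}"
  let ?L = "{ys. set ys \<subseteq> insert None (Some ` X) \<and> length ys = K}"
  show "finite ?S" using assms by simp
  have fin: "finite ?L" using assms by (intro finite_lists_length_eq) simp
  have "?S \<subseteq> (\<lambda>ys. {x. Some x \<in> set ys}) ` ?L"
  proof
    fix A assume A: "A \<in> ?S"
    then have "finite A" using assms by (auto intro: finite_subset)
    then obtain xs where xs: "set xs = A" "distinct xs" using finite_distinct_list[of A] by blast
    then have "length xs \<le> K" using A distinct_card[of xs] by simp
    then show "A \<in> (\<lambda>ys. {x. Some x \<in> set ys}) ` ?L"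
      using xs A by (intro image_eqI[of _ _ "map Some xs @ replicate (K - length xs) None"]) auto
  qed
  then have "card ?S \<le> card ?L" using fin by (rule surj_card_le[rotated])
  also have "\<dots> = (card X + 1) ^ K"
    using assms by (subst card_lists_length_eq) (auto simp: card_image)
  finally show "card ?S \<le> (card X + 1) ^ K" .
qed

definition vertex_bits :: "nat \<Rightarrow> nat" where
  "vertex_bits n = nat \<lceil>log 2 (real n + 2)\<rceil>"

text \<open>The pass counter takes \<open>2 * k + 3\<close> bits; \<open>M\<close> and
  \<open>F\<close> have at most \<open>2 * k + 1\<close> arcs each, at
  \<open>2 * vertex_bits n\<close> bits per arc.\<close>

definition memory_bits :: "nat \<Rightarrow> nat \<Rightarrow> nat" where
  "memory_bits n k = (2 * k + 3) + 4 * (2 * k + 1) * vertex_bits n"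

lemma le_two_power_vertex_bits: "n + 2 \<le> 2 ^ vertex_bits n"
proof -
  have "real n + 2 = 2 powr log 2 (real n + 2)" by simp
  also have "\<dots> \<le> 2 powr real (vertex_bits n)"
    unfolding vertex_bits_def by (intro powr_mono) linarith+
  also have "\<dots> = real (2 ^ vertex_bits n)" by (simp add: powr_realpow)
  finally show ?thesis by linarith
qed

lemma card_machine_states:
  "finite (machine_states n k)" "card (machine_states n k) \<le> 2 ^ memory_bits n k"
proof -
  let ?D = "{..<n} \<times> {..<n}" and ?K = "2 * k + 1"
  let ?S = "{A. A \<subseteq> ?D \<and> card A \<le> ?K}"
  have sub: "Collect (search_inv ?D k) \<subseteq> ?S \<times> ?S"
  proof
    fix s assume "s \<in> Collect (search_inv ?D k)"
    moreover obtain M F where s: "s = (M, F)" by (metis surj_pair)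
    ultimately have inv: "search_inv ?D k (M, F)" by simp
    then have "M \<subseteq> ?D" "F \<subseteq> ?D" by (auto simp: search_inv_def)
    then show "s \<in> ?S \<times> ?S" using search_inv_card[OF inv] by (simp add: s)
  qed
  have fin: "finite ?S" by (intro card_small_subsets) simp
  show "finite (machine_states n k)"
    unfolding machine_states_def using finite_subset[OF sub] fin by simp
  have "card ?D + 1 \<le> (n + 2) ^ 2" by (simp add: power2_eq_square)
  also have "\<dots> \<le> (2 ^ vertex_bits n) ^ 2" by (intro power_mono le_two_power_vertex_bits) simp
  finally have D: "card ?D + 1 \<le> (2 ^ vertex_bits n) ^ 2" .
  have "card ?S \<le> (card ?D + 1) ^ ?K" by (intro card_small_subsets) simp
  also have "\<dots> \<le> ((2 ^ vertex_bits n) ^ 2) ^ ?K" using D by (rule power_mono) simp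
  finally have S: "card ?S \<le> 2 ^ (vertex_bits n * 2 * ?K)" unfolding power_mult .
  \<comment> \<open>A crude exponential bound on the counter suffices, because a number of bits
    linear in \<open>k\<close> is affordable.\<close>
  have "k + 1 \<le> 2 ^ k" using less_exp[of k] by linarith
  then have "2 * k + 2 \<le> 2 ^ (k + 1)" by simp
  then have "(2 * k + 2)\<^sup>2 \<le> (2 ^ (k + 1))\<^sup>2" by (rule power_mono) simp
  also have "\<dots> = 2 ^ (2 * k + 2)" by (simp flip: power_mult add: mult.commute)
  finally have "(2 * k + 2)\<^sup>2 + 1 \<le> 2 ^ (2 * k + 2) + (2 :: nat) ^ (2 * k + 2)"
    by (intro add_mono) simp_all
  then have P: "(2 * k + 2)\<^sup>2 + 1 \<le> (2 :: nat) ^ (2 * k + 3)"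
    by (simp add: eval_nat_numeral)
  have "card (machine_states n k) \<le> ((2 * k + 2)\<^sup>2 + 1) * card (?S \<times> ?S)"
    unfolding machine_states_def card_cartesian_product[of "{.._}"]
    using card_mono[OF _ sub] fin by (intro mult_mono) auto
  also have "\<dots> \<le> 2 ^ (2 * k + 3) * (2 ^ (vertex_bits n * 2 * ?K) * 2 ^ (vertex_bits n * 2 * ?K))"
    using P S by (simp only: card_cartesian_product) (intro mult_mono; simp)
  also have "\<dots> = 2 ^ memory_bits n k"
    unfolding memory_bits_def by (simp only: flip: power_add) (simp add: algebra_simps)
  finally show "card (machine_states n k) \<le> 2 ^ memory_bits n k" .
qed

lemma memory_bits_le: "real (memory_bits n k) \<le> 29 * real (max 1 k) * log 2 (real n + 2) ^ 1"
proof -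
  define l where "l = log 2 (real n + 2)"
  define m where "m = real (max 1 k)"
  have l: "1 \<le> l" unfolding l_def by (simp add: le_log_iff)
  have m: "1 \<le> m" "real k \<le> m" unfolding m_def by auto
  \<comment> \<open>Rounding up at most doubles \<open>l\<close>, as
    \<open>1 \<le> l\<close>.\<close>
  have b: "real (vertex_bits n) \<le> 2 * l"
    using l unfolding vertex_bits_def l_def[symmetric] by linarith
  have "real (memory_bits n k) = (2 * real k + 3) + 4 * (2 * real k + 1) * real (vertex_bits n)"
    by (simp add: memory_bits_def)
  also have "\<dots> \<le> 5 * m + 4 * (3 * m) * (2 * l)"
    using m l b by (intro add_mono mult_mono) auto
  also have "\<dots> \<le> 5 * (m * l) + 24 * (m * l)"
    using m l by (auto simp: mult_le_cancel_left1)
  finally show ?thesis by (simp add: l_def m_def)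
qed

text \<open>The two assumptions isolate what depends on the stream model: the items announce exactly
  the arcs, and filtering the items one by one yields a stream of an induced subgraph.\<close>

lemma ex_kernel_algorithm:
  fixes is_stream :: "graph \<Rightarrow> 'i list \<Rightarrow> bool"
  assumes dir: "\<And>G xs. simple_graph G \<Longrightarrow> is_stream G xs \<Longrightarrow> set (concat (map dir xs)) = arcs G"
    and ends: "\<And>G xs W. simple_graph G \<Longrightarrow> is_stream G xs \<Longrightarrow> W \<subseteq> verts G \<Longrightarrow>
      is_stream (induced G W) (filter (\<lambda>i. ends i \<subseteq> W) xs)"
  shows "\<exists>A. produces_2k_kernel is_stream A \<and> passes_O_power A 2 \<and> memory_soft_O_k is_stream A"
proof -
  \<comment> \<open>All codes have the same length, so the memory use is constant throughout the
    run.\<close>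
  define enc :: "nat \<Rightarrow> nat \<Rightarrow> nat \<times> (nat \<times> nat) set \<times> (nat \<times> nat) set \<Rightarrow> bool list" where
    "enc n k = (SOME e. inj_on e (machine_states n k) \<and>
      (\<forall>s\<in>machine_states n k. length (e s) = memory_bits n k))" for n k
  have enc: "inj_on (enc n k) (machine_states n k) \<and>
      (\<forall>s\<in>machine_states n k. length (enc n k s) = memory_bits n k)" for n k
    unfolding enc_def using ex_bit_encoding[OF card_machine_states] by (rule someI_ex)
  have inj: "inj_on (enc n k) (machine_states n k)" for n k
    using enc by (rule conjunct1)
  have len: "length (enc n k s) = memory_bits n k" if "s \<in> machine_states n k" for n k s
    using enc that by blast
  define s0 :: "nat \<times> (nat \<times> nat) set \<times> (nat \<times> nat) set" where "s0 = (0, {}, {})"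
  \<comment> \<open>The \<open>Suc\<close> in \<open>passes\<close> accounts for the output pass
    that follows the search.\<close>
  define A :: "'i streaming_alg" where
    "A = \<lparr>passes = \<lambda>n k. Suc ((2 * k + 2)\<^sup>2), init = \<lambda>n k. enc n k s0,
      step = \<lambda>n k. coded (enc n k) (machine_states n k) (machine dir ends k),
      verdict = \<lambda>n k m. decide k (snd (inv_into (machine_states n k) (enc n k) m))\<rparr>"
  have inv0: "search_inv D k (snd s0)" for D k
    unfolding s0_def snd_conv by (rule search_inv_matching) (simp_all add: matching_def)
  have s0: "s0 \<in> machine_states n k" for n k
    using inv0 by (simp add: s0_def machine_states_def)
  have exec: "exec (step A n k) (init A n k) ys = map_prod (enc n k) id (run (machine dir ends k) s0 ys)
      \<and> fst (run (machine dir ends k) s0 ys) \<in> machine_states n k"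
    if "input_graph n G" "is_stream G xs" "set ys \<subseteq> insert None (Some ` set xs)" for n k G xs ys
  proof -
    have "simple_graph G" "verts G = {..<n}" using that(1) by (simp_all add: input_graph_def)
    then have sub: "set (concat (map dir xs)) \<subseteq> {..<n} \<times> {..<n}"
      using dir[of G xs] arcs_subset[of G] that(2) by simp
    have "fst (machine dir ends k s x) \<in> machine_states n k"
      if "s \<in> machine_states n k" "x \<in> insert None (Some ` set xs)" for s x
      using that(1)
    proof (rule machine_closed)
      fix i assume "x = Some i"
      then have "i \<in> set xs" using that(2) by auto
      then show "set (dir i) \<subseteq> {..<n} \<times> {..<n}" using sub by auto
    qed
    then show ?thesis
      unfolding A_def streaming_alg.simps using s0 that(3) by (rule exec_coded[OF inj])
  qed
  have set_tape: "set (tape p xs) \<subseteq> insert None (Some ` set xs)" for p and xs :: "'i list"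
    by (auto simp: tape_def)
  have "produces_2k_kernel is_stream A"
    unfolding produces_2k_kernel_def
  proof (intro allI impI)
    fix n k G xs assume G: "input_graph n G" and xs: "is_stream G xs"
    have simple: "simple_graph G" using G by (simp add: input_graph_def)
    let ?es = "concat (map dir xs)"
    define s where "s = (fold (update k) ?es ^^ (2 * k + 2)\<^sup>2) (snd s0)"
    have fin: "finite (arcs G)"
      using arcs_subset[OF simple] simple by (auto simp: simple_graph_def intro: finite_subset)
    have es: "set ?es = arcs G" using dir[OF simple xs] .
    have s: "search_inv (arcs G) k s" "\<forall>e\<in>arcs G. update k e s = s"
      using search_stabilizes[OF inv0 fin, of ?es k] unfolding s_def es by auto
    let ?out = "filter (\<lambda>i. ends i \<subseteq> half_integral s) xs"
    have run: "run (machine dir ends k) s0 (tape (passes A n k) xs) = (((2 * k + 2)\<^sup>2, s), ?out)"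
      by (simp only: A_def streaming_alg.simps s0_def s_def tape_Suc run_append[where xs = "tape p ys" for p ys] Let_def prod.case
          snd_conv append_Nil run_search_passes[OF order_refl] run_output[OF less_irrefl])
    have "final_config A n k xs = (enc n k ((2 * k + 2)\<^sup>2, s), ?out)"
      and mem: "((2 * k + 2)\<^sup>2, s) \<in> machine_states n k"
      using exec[OF G xs set_tape, of k "passes A n k"] unfolding run
      by (simp_all add: final_config_def)
    moreover have "verdict A n k (enc n k ((2 * k + 2)\<^sup>2, s)) = decide k s"
      using inj mem by (simp add: A_def)
    moreover have "half_integral s \<subseteq> verts G"
      using half_integral_subset[OF search_inv_mono[OF s(1) arcs_subset[OF simple]]] .
    ultimately show "case final_config A n k xs of (m, out) \<Rightarrow>
        (case verdict A n k m of No_Solution \<Rightarrow> \<not> has_vertex_cover G k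
         | Kernel k' \<Rightarrow> \<exists>G'. is_stream G' out \<and> is_2k_kernel G k G' k')"
      using decide_stable[OF simple s] ends[OF simple xs] by (auto split: verdict.splits)
  qed
  moreover have "passes_O_power A 2"
    unfolding passes_O_power_def
  proof (intro exI allI)
    fix n k :: nat
    have "2 * k + 2 \<le> 4 * max 1 k" by linarith
    then have "(2 * k + 2)\<^sup>2 \<le> (4 * max 1 k)\<^sup>2" by (rule power_mono) simp
    also have "\<dots> = 16 * (max 1 k)\<^sup>2" by (simp add: power_mult_distrib)
    finally have "(2 * k + 2)\<^sup>2 \<le> 16 * (max 1 k)\<^sup>2" .
    moreover have "1 \<le> (max 1 k)\<^sup>2" by (rule one_le_power) simp
    moreover have "passes A n k = (2 * k + 2)\<^sup>2 + 1" by (simp add: A_def)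
    ultimately show "passes A n k \<le> 17 * (max 1 k)\<^sup>2" by linarith
  qed
  moreover have "memory_soft_O_k is_stream A"
    unfolding memory_soft_O_k_def
  proof (intro exI allI impI)
    fix n k G xs t assume G: "input_graph n G" and xs: "is_stream G xs"
    have "set (take t (tape (passes A n k) xs)) \<subseteq> insert None (Some ` set xs)"
      using set_tape set_take_subset by fast
    from exec[OF G xs this, of k] have "length (fst (config_at A n k xs t)) = memory_bits n k"
      by (simp add: config_at_def len)
    then show "real (length (fst (config_at A n k xs t)))
        \<le> 29 * real (max 1 k) * log 2 (real n + 2) ^ 1"
      using memory_bits_le by simp
  qed
  ultimately show ?thesis by blast
qed


subsection \<open>The two stream models\<close>

fun al_arcs :: "al_item \<Rightarrow> (nat \<times> nat) list" where
  "al_arcs (Vertex v) = []"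
| "al_arcs (Incidence v w) = [(v, w)]"

fun al_ends :: "al_item \<Rightarrow> nat set" where
  "al_ends (Vertex v) = {v}"
| "al_ends (Incidence v w) = {v, w}"

text \<open>The two lists that contain an edge contribute its two orientations.\<close>

lemma al_stream_arcs:
  assumes "simple_graph G" "al_stream G xs"
  shows "set (concat (map al_arcs xs)) = arcs G"
proof -
  obtain vs nbrs where vs: "set vs = verts G"
    and nbrs: "\<forall>v\<in>verts G. set (nbrs v) = {w. {v, w} \<in> edges G}"
    and xs: "xs = concat (map (\<lambda>v. Vertex v # map (Incidence v) (nbrs v)) vs)"
    using assms(2) unfolding al_stream_def by blast
  have "set (concat (map al_arcs xs)) = (\<Union>v\<in>verts G. Pair v ` set (nbrs v))"
    by (auto simp: xs vs)
  also have "\<dots> = {(v, w). v \<in> verts G \<and> {v, w} \<in> edges G}" using nbrs by auto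
  also have "\<dots> = arcs G" using arcs_subset[OF assms(1)] unfolding arcs_def by blast
  finally show ?thesis .
qed

text \<open>All items in the list of a vertex mention it. So the list of a vertex outside
  \<open>W\<close> disappears as a whole, while the other lists are merely thinned out.\<close>

lemma al_stream_induced:
  assumes "al_stream G xs" "W \<subseteq> verts G"
  shows "al_stream (induced G W) (filter (\<lambda>i. al_ends i \<subseteq> W) xs)"
proof -
  obtain vs nbrs where vs: "distinct vs" "set vs = verts G"
    and nbrs: "\<forall>v\<in>verts G. distinct (nbrs v) \<and> set (nbrs v) = {w. {v, w} \<in> edges G}"
    and xs: "xs = concat (map (\<lambda>v. Vertex v # map (Incidence v) (nbrs v)) vs)"
    using assms(1) unfolding al_stream_def by blast
  let ?nbrs = "\<lambda>v. filter (\<lambda>w. w \<in> W) (nbrs v)"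
  have item: "filter (\<lambda>i. al_ends i \<subseteq> W) (map (Incidence v) ws)
      = (if v \<in> W then map (Incidence v) (filter (\<lambda>w. w \<in> W) ws) else [])" for v ws
    by (induction ws) auto
  have "filter (\<lambda>i. al_ends i \<subseteq> W) xs
      = concat (map (\<lambda>v. Vertex v # map (Incidence v) (?nbrs v)) (filter (\<lambda>v. v \<in> W) vs))"
    unfolding xs by (induction vs) (simp_all add: item)
  moreover have "distinct (filter (\<lambda>v. v \<in> W) vs)" "set (filter (\<lambda>v. v \<in> W) vs) = W"
    using vs assms(2) by auto
  moreover have "distinct (?nbrs v) \<and> set (?nbrs v) = {w. {v, w} \<in> edges (induced G W)}"
    if "v \<in> W" for v
    using nbrs that assms(2) by (auto simp: induced_def)
  ultimately show ?thesis
    unfolding al_stream_def by (intro exI[of _ "filter (\<lambda>v. v \<in> W) vs"] exI[of _ ?nbrs])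
      (simp add: induced_def)
qed

lemma ea_stream_arcs:
  assumes "ea_stream G xs"
  shows "set (concat (map (\<lambda>(u, v). [(u, v), (v, u)]) xs)) = arcs G"
proof -
  have E: "edges G = (\<lambda>(u, v). {u, v}) ` set xs" using assms by (simp add: ea_stream_def)
  show ?thesis unfolding arcs_def E by (auto simp: doubleton_eq_iff image_iff split: prod.splits)
qed

lemma ea_stream_induced:
  assumes "ea_stream G xs"
  shows "ea_stream (induced G W) (filter (\<lambda>i. {fst i, snd i} \<subseteq> W) xs)"
proof -
  have E: "edges G = (\<lambda>(u, v). {u, v}) ` set xs" and d: "distinct (map (\<lambda>(u, v). {u, v}) xs)"
    using assms by (auto simp: ea_stream_def)
  have "edges (induced G W) = (\<lambda>(u, v). {u, v}) ` set (filter (\<lambda>i. {fst i, snd i} \<subseteq> W) xs)"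
    unfolding induced_def by (auto simp: E image_iff split: prod.splits, blast)
  then show ?thesis using distinct_map_filter[OF d] by (simp add: ea_stream_def)
qed

lemma passes_O_power_mono:
  assumes "passes_O_power A d" "d \<le> e" shows "passes_O_power A e"
proof -
  obtain c where c: "\<And>n k. passes A n k \<le> c * max 1 k ^ d"
    using assms(1) by (auto simp: passes_O_power_def)
  have "c * max 1 k ^ d \<le> c * max 1 k ^ e" for k :: nat
    using assms(2) by (intro mult_left_mono power_increasing) auto
  then show ?thesis using c le_trans unfolding passes_O_power_def by blast
qed

theorem theorem44:
  "(\<exists>A. produces_2k_kernel al_stream A \<and> passes_O_power A 2 \<and> memory_soft_O_k al_stream A) \<and>
   (\<exists>A. produces_2k_kernel ea_stream A \<and> passes_O_power A 3 \<and> memory_soft_O_k ea_stream A)"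
proof
  show "\<exists>A. produces_2k_kernel al_stream A \<and> passes_O_power A 2 \<and> memory_soft_O_k al_stream A"
    by (rule ex_kernel_algorithm[of al_stream al_arcs al_ends, OF al_stream_arcs al_stream_induced])
  \<comment> \<open>Each item announces both orientations of its edge, so the quadratic pass bound
    carries over to edge arrival and implies the cubic one.\<close>
  obtain A where "produces_2k_kernel ea_stream A" "passes_O_power A 2" "memory_soft_O_k ea_stream A"
    using ex_kernel_algorithm[of ea_stream "\<lambda>(u, v). [(u, v), (v, u)]" "\<lambda>i. {fst i, snd i}",
      OF ea_stream_arcs ea_stream_induced] by blast
  then show "\<exists>A. produces_2k_kernel ea_stream A \<and> passes_O_power A 3 \<and> memory_soft_O_k ea_stream A"
    using passes_O_power_mono[of A 2 3] by auto
qed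

end
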